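(* Any (randomized) algorithm that, given {\textsc{SET-EVAL}} access to an unknown distribution $D$ on $[n]$, approximates the support size $|\mathrm{supp}(D)|$ within a multiplicative $4/3$-factor with probability at least $2/3$, must make $\Omega(\log\log\log n)$ queries.
   Context: $[n]=\{1,\dots,n\}$. For a distribution $D$ on $[n]$ and $S\subseteq[n]$, $D(S)=\sum_{i\in S}D(i)$, and $\mathrm{supp}(D)=\{x:D(x)>0\}$. A {\textsc{SET-EVAL}} oracle for $D$ takes as input any set $S\subseteq[n]$ (possibly chosen adaptively) and returns the exact value $D(S)$. An estimate $N$ is within a multiplicative $4/3$-factor if $\frac34|\mathrm{supp}(D)|\le N\le\frac43|\mathrm{supp}(D)|$. The guarantee must hold for every distribution $D$ on $[n]$. *)

theory Defs
  imports "HOL-Probability.Probability"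
begin

definition dists_on :: "nat \<Rightarrow> nat pmf set" where
  "dists_on n = {D. set_pmf D \<subseteq> {1..n}}"

text \<open>
  A deterministic adaptive algorithm is a decision tree: it either outputs an estimate, or
  asks for the mass of a set and continues depending on the exact answer.
\<close>

datatype set_eval_tree =
    Output real
  | Query "nat set" "real \<Rightarrow> set_eval_tree"

primrec queries_within :: "nat set \<Rightarrow> set_eval_tree \<Rightarrow> bool" where
  "queries_within X (Output N) = True"
| "queries_within X (Query S k) = (S \<subseteq> X \<and> (\<forall>a. queries_within X (k a)))"

primrec estimate :: "nat pmf \<Rightarrow> set_eval_tree \<Rightarrow> real" where
  "estimate D (Output N) = N"
| "estimate D (Query S k) = estimate D (k (measure_pmf.prob D S))"

primrec num_queries :: "nat pmf \<Rightarrow> set_eval_tree \<Rightarrow> nat" where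
  "num_queries D (Output N) = 0"
| "num_queries D (Query S k) = Suc (num_queries D (k (measure_pmf.prob D S)))"

text \<open>
  A randomized algorithm is a probability measure on decision trees.  The sigma-algebra is
  arbitrary, so a family of trees indexed by any probability space is covered by taking its
  image measure.
\<close>

definition randomized_algorithm :: "nat \<Rightarrow> set_eval_tree measure \<Rightarrow> bool" where
  "randomized_algorithm n A \<longleftrightarrow> prob_space A \<and> (\<forall>t\<in>space A. queries_within {1..n} t)"

definition approximates_supp :: "nat pmf \<Rightarrow> real \<Rightarrow> bool" where
  "approximates_supp D N \<longleftrightarrow>
     3/4 * real (card (set_pmf D)) \<le> N \<and> N \<le> 4/3 * real (card (set_pmf D))"

text \<open>
  No separate measurability condition is needed: a non-measurable set has
  \<^const>\<open>measure\<close> zero, so the lower bound of 2/3 forces the success event to be measurable.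
\<close>

definition estimates_support_size :: "nat \<Rightarrow> set_eval_tree measure \<Rightarrow> bool" where
  "estimates_support_size n A \<longleftrightarrow>
     (\<forall>D\<in>dists_on n. measure A {t \<in> space A. approximates_supp D (estimate D t)} \<ge> 2/3)"

text \<open>
  Worst-case query complexity, over all inputs and (up to null events) all random choices.
\<close>

definition query_bound :: "nat \<Rightarrow> set_eval_tree measure \<Rightarrow> nat \<Rightarrow> bool" where
  "query_bound n A q \<longleftrightarrow> (\<forall>D\<in>dists_on n. AE t in A. num_queries D t \<le> q)"

end

theory Submission imports Defs "HOL-Library.Discrete_Functions"
begin

text \<open>
  Let the support be \<open>{1..k}\<close> with \<open>k = 2^j\<close> for uniformly random \<open>j < L\<close>, where \<open>L\<close> is about
  \<open>log n\<close>, and let the weights \<open>w i\<close> be independent and uniform on \<open>{1..2^(n-i)}\<close>.  The first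
  element of a set \<open>A\<close> masks the contribution of all others: if \<open>A\<close> meets the support, every
  possible value of its mass has probability at most \<open>1 / 2^(n - Min A)\<close>, and there are at
  most \<open>2 * 2^(n - Min A)\<close> values.  Both bounds are independent of \<open>k\<close>, so up to a factor of 2
  the mass only tells whether \<open>A\<close> meets the support.  Even if the algorithm is given the masses
  of all atoms of the Venn diagram of its queries, at most \<open>2^q\<close> in number, it gains
  at most a factor \<open>3\<close> per atom over guessing, so \<open>L \<le> 3^(2^q)\<close>.
\<close>

section \<open>Hard inputs, their masses and charges\<close>

text \<open>The range of weight \<open>i\<close> is about as large as all later ranges together, so
  the first supported element of a set dominates its mass. Extensional functions keep the set
  finite, and probabilities become counts.\<close>

definition weightings :: "nat \<Rightarrow> (nat \<Rightarrow> nat) set" where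
  "weightings n = (\<Pi>\<^sub>E i\<in>{1..n}. {1..2^(n-i)})"

definition mass :: "nat \<times> (nat \<Rightarrow> nat) \<Rightarrow> nat set \<Rightarrow> nat" where
  "mass z A = (\<Sum>i\<in>A \<inter> {1..fst z}. snd z i)"

text \<open>
  An upper bound, uniform in the support size, for the probability that \<open>A\<close> has mass \<open>x\<close>.
\<close>

definition charge :: "nat \<Rightarrow> nat set \<Rightarrow> nat \<Rightarrow> real" where
  "charge n A x = (if x = 0 then 1 else 1 / 2^(n - Min A))"

text \<open>The list records Venn atoms with their integer masses. A list keeps empty and repeated
  atoms, so that each query doubles its length exactly.\<close>

definition consistent :: "nat \<times> (nat \<Rightarrow> nat) \<Rightarrow> (nat set \<times> nat) list \<Rightarrow> bool" where
  "consistent z ps \<longleftrightarrow> (\<forall>(A, x)\<in>set ps. mass z A = x)"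

definition total_charge :: "nat \<Rightarrow> (nat set \<times> nat) list \<Rightarrow> real" where
  "total_charge n ps = (\<Prod>(A, x)\<leftarrow>ps. charge n A x)"

abbreviation disjoint_atoms :: "(nat set \<times> nat) list \<Rightarrow> bool" where
  "disjoint_atoms \<equiv> sorted_wrt (\<lambda>p p'. fst p \<inter> fst p' = {})"

abbreviation covered :: "(nat set \<times> nat) list \<Rightarrow> nat set" where
  "covered ps \<equiv> \<Union>(fst ` set ps)"

definition dist_of :: "nat \<times> (nat \<Rightarrow> nat) \<Rightarrow> nat pmf" where
  "dist_of z = pmf_of_multiset (\<Sum>i\<in>{1..fst z}. replicate_mset (snd z i) i)"

text \<open>Consecutive support sizes have ratio 2, which exceeds (4/3)/(3/4) = 16/9. All sizes
  share the same weightings, hence the same count to normalise by.\<close>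

definition inputs :: "nat \<Rightarrow> nat \<Rightarrow> (nat \<times> (nat \<Rightarrow> nat)) set" where
  "inputs n L = (\<lambda>j. 2^j) ` {..<L} \<times> weightings n"

definition solved :: "nat \<Rightarrow> nat \<Rightarrow> nat \<Rightarrow> set_eval_tree \<Rightarrow> (nat \<times> (nat \<Rightarrow> nat)) set" where
  "solved n L d t = {z \<in> inputs n L. num_queries (dist_of z) t \<le> d \<and>
     approximates_supp (dist_of z) (estimate (dist_of z) t)}"

lemma finite_weightings [simp]: "finite (weightings n)"
  unfolding weightings_def by (intro finite_PiE) auto

lemma finite_inputs [simp]: "finite (inputs n L)"
  unfolding inputs_def by simp

lemma finite_solved [simp]: "finite (solved n L d t)"
  unfolding solved_def by simp

lemma card_weightings_pos: "card (weightings n) > 0"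
  unfolding weightings_def by (auto simp: card_PiE intro!: prod_pos)

lemma weightings_pos: "w \<in> weightings n \<Longrightarrow> i \<in> {1..n} \<Longrightarrow> 0 < w i"
  unfolding weightings_def by (drule (1) PiE_mem) simp

lemma charge_nonneg [simp]: "0 \<le> charge n A x"
  unfolding charge_def by simp

lemma total_charge_nonneg [simp]: "0 \<le> total_charge n ps"
  unfolding total_charge_def by (induction ps) auto

lemma total_charge_simps [simp]:
  "total_charge n [] = 1"
  "total_charge n (p # ps) = charge n (fst p) (snd p) * total_charge n ps"
  "total_charge n (ps @ ps') = total_charge n ps * total_charge n ps'"
  unfolding total_charge_def by (auto simp: case_prod_beta)

lemma consistent_simps [simp]:
  "consistent z []"
  "consistent z (p # ps) \<longleftrightarrow> mass z (fst p) = snd p \<and> consistent z ps"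
  "consistent z (ps @ ps') \<longleftrightarrow> consistent z ps \<and> consistent z ps'"
  unfolding consistent_def by (auto simp: case_prod_beta)

section \<open>Additivity and bounds of masses\<close>

lemma mass_Un: "A \<inter> B = {} \<Longrightarrow> mass z (A \<union> B) = mass z A + mass z B"
  unfolding mass_def Int_Un_distrib2 by (rule sum.union_disjoint) auto

lemma mass_empty [simp]: "mass z {} = 0"
  unfolding mass_def by simp

lemma mass_covered:
  "disjoint_atoms ps \<Longrightarrow> consistent z ps \<Longrightarrow> mass z (covered ps) = (\<Sum>p\<leftarrow>ps. snd p)"
proof (induction ps)
  case (Cons p ps)
  have "mass z (covered (p # ps)) = mass z (fst p \<union> covered ps)"
    by simp
  also have "\<dots> = mass z (fst p) + mass z (covered ps)"
    using Cons.prems by (intro mass_Un) auto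
  finally show ?case
    using Cons by simp
qed simp

lemma sum_pow_atLeast: "(\<Sum>i\<in>{m..n}. 2^(n-i)) \<le> 2 * (2::nat)^(n-m)" if "m \<le> n"
proof -
  have "(\<Sum>i\<in>{m..n}. (2::nat)^(n-i)) = (\<Sum>j\<le>n-m. 2^j)"
    by (rule sum.reindex_bij_witness[of _ "\<lambda>j. n - j" "\<lambda>i. n - i"]) (use that in auto)
  also have "\<dots> \<le> 2 * 2^(n-m)"
    using sum_power2[of "Suc (n - m)"] by (simp add: atLeast0LessThan lessThan_Suc_atMost)
  finally show ?thesis .
qed

text \<open>The geometric series from \<open>Min A\<close> on is at most twice its first term. With
  \<open>mass_le\<close> this bounds the number of positive masses that \<open>A\<close> can
  attain.\<close>

lemma sum_pow_le:
  assumes "A \<subseteq> {1..n}" "A \<noteq> {}"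
  shows "(\<Sum>i\<in>A. 2^(n-i)) \<le> 2 * (2::nat)^(n - Min A)"
proof -
  have fin: "finite A"
    using assms finite_subset by blast
  have "Min A \<in> A"
    using fin assms by simp
  hence "Min A \<le> n"
    using assms by auto
  moreover have "A \<subseteq> {Min A..n}"
    using fin assms by auto
  hence "(\<Sum>i\<in>A. (2::nat)^(n-i)) \<le> (\<Sum>i\<in>{Min A..n}. 2^(n-i))"
    by (intro sum_mono2) auto
  ultimately show ?thesis
    using sum_pow_atLeast[of "Min A" n] by linarith
qed

lemma mass_le:
  assumes "A \<subseteq> {1..n}" "snd z \<in> weightings n"
  shows "mass z A \<le> (\<Sum>i\<in>A. 2^(n-i))"
proof -
  have "finite A"
    using assms finite_subset by blast
  have "mass z A \<le> (\<Sum>i\<in>A \<inter> {1..fst z}. 2^(n-i))"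
    unfolding mass_def using assms by (intro sum_mono) (auto simp: weightings_def PiE_iff)
  also have "\<dots> \<le> (\<Sum>i\<in>A. 2^(n-i))"
    using \<open>finite A\<close> by (intro sum_mono2) auto
  finally show ?thesis .
qed

text \<open>The support is an initial segment, so it contains \<open>Min A\<close> as soon as it
  contains any element of \<open>A\<close>.\<close>

lemma mass_pos_Min:
  assumes "A \<subseteq> {1..n}" "snd z \<in> weightings n" "mass z A > 0"
  shows "Min A \<in> A \<inter> {1..fst z}"
proof -
  have fin: "finite A"
    using assms finite_subset by blast
  obtain i where "i \<in> A \<inter> {1..fst z}"
    using assms(3) unfolding mass_def by (metis ex_in_conv less_irrefl sum.empty)
  moreover from this have "Min A \<in> A" "Min A \<le> i"
    using fin by (auto intro: Min_in)
  ultimately show ?thesis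
    using assms(1) by auto
qed

lemma mass_pos:
  assumes "snd z \<in> weightings n" "i \<in> A \<inter> {1..fst z}" "A \<subseteq> {1..n}"
  shows "mass z A > 0"
proof -
  have "0 < snd z i"
    using assms weightings_pos by auto
  also have "\<dots> \<le> mass z A"
    unfolding mass_def using assms(2) by (intro member_le_sum) auto
  finally show ?thesis .
qed

text \<open>
  Since the support is an initial segment, the part with the smaller minimum carries mass
  whenever the atom does.  The other part either has mass zero, or one of at most
  \<open>2 * 2^(n - Min A2)\<close> positive masses, each of charge \<open>1 / 2^(n - Min A2)\<close>; hence the
  factor \<open>3 = 1 + 2\<close>.
\<close>

lemma card_split_atom:
  assumes Z: "finite Z" "\<And>z. z \<in> Z \<Longrightarrow> snd z \<in> weightings n"
    and A: "A1 \<union> A2 \<subseteq> {1..n}" "A1 \<inter> A2 = {}" "A1 \<union> A2 \<noteq> {} \<Longrightarrow> Min (A1 \<union> A2) \<in> A1"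
    and C: "0 \<le> C"
    and bound: "\<And>a b. real (card {z \<in> Z. mass z A1 = a \<and> mass z A2 = b})
                  \<le> C * charge n A1 a * charge n A2 b"
  shows "real (card {z \<in> Z. mass z (A1 \<union> A2) = x}) \<le> 3 * C * charge n (A1 \<union> A2) x"
proof (cases "x = 0 \<or> A1 \<union> A2 = {}")
  case True
  show ?thesis
  proof (cases "x = 0")
    case True
    have "{z \<in> Z. mass z (A1 \<union> A2) = x} = {z \<in> Z. mass z A1 = 0 \<and> mass z A2 = 0}"
      using True mass_Un[OF A(2)] by auto
    thus ?thesis
      using bound[of 0 0] C True by (simp add: charge_def)
  next
    case False
    hence "{z \<in> Z. mass z (A1 \<union> A2) = x} = {}"
      using \<open>x = 0 \<or> A1 \<union> A2 = {}\<close> by auto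
    thus ?thesis
      using C by (metis card.empty of_nat_0 charge_nonneg mult_nonneg_nonneg zero_le_numeral)
  qed
next
  case False
  define s where "s = (\<Sum>i\<in>A2. (2::nat)^(n-i))"
  \<comment> \<open>\<open>b\<close> ranges over the possible masses of \<open>A2\<close>;
    \<open>b < x\<close> because \<open>A1\<close> has positive mass.\<close>
  define B where "B = {b. b \<le> s \<and> b < x}"
  have fin: "finite A1" "finite A2"
    using A(1) finite_subset[of _ "{1..n}"] by auto
  have Min_eq: "Min A1 = Min (A1 \<union> A2)"
    using A(3) False fin by (intro Min_eqI) auto
  have "{z \<in> Z. mass z (A1 \<union> A2) = x} \<subseteq> (\<Union>b\<in>B. {z \<in> Z. mass z A1 = x - b \<and> mass z A2 = b})"
  proof
    fix z assume z: "z \<in> {z \<in> Z. mass z (A1 \<union> A2) = x}"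
    hence w: "snd z \<in> weightings n"
      using Z by simp
    have "mass z A2 \<le> s"
      unfolding s_def using A w by (intro mass_le) auto
    moreover have "Min (A1 \<union> A2) \<in> (A1 \<union> A2) \<inter> {1..fst z}"
      using z False A(1) w by (intro mass_pos_Min) auto
    hence "mass z A1 > 0"
      using A False by (intro mass_pos[OF w, of "Min (A1 \<union> A2)"]) auto
    ultimately show "z \<in> (\<Union>b\<in>B. {z \<in> Z. mass z A1 = x - b \<and> mass z A2 = b})"
      using z mass_Un[OF A(2)] by (auto simp: B_def)
  qed
  hence "card {z \<in> Z. mass z (A1 \<union> A2) = x}
           \<le> card (\<Union>b\<in>B. {z \<in> Z. mass z A1 = x - b \<and> mass z A2 = b})"
    using Z(1) by (intro card_mono) (auto simp: B_def)
  also have "\<dots> \<le> (\<Sum>b\<in>B. card {z \<in> Z. mass z A1 = x - b \<and> mass z A2 = b})"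
    by (intro card_UN_le) (auto simp: B_def)
  finally have "real (card {z \<in> Z. mass z (A1 \<union> A2) = x})
           \<le> (\<Sum>b\<in>B. real (card {z \<in> Z. mass z A1 = x - b \<and> mass z A2 = b}))"
    by (simp flip: of_nat_sum)
  also have "\<dots> \<le> (\<Sum>b\<in>B. C * charge n A1 (x - b) * charge n A2 b)"
    by (intro sum_mono bound)
  \<comment> \<open>Both \<open>x - b\<close> and \<open>x\<close> are positive and the minima
    agree, so the two charges coincide.\<close>
  also have "\<dots> = (\<Sum>b\<in>B. C * charge n (A1 \<union> A2) x * charge n A2 b)"
    using False by (intro sum.cong) (auto simp: B_def charge_def Min_eq)
  also have "\<dots> = C * charge n (A1 \<union> A2) x * (\<Sum>b\<in>B. charge n A2 b)"
    by (simp add: sum_distrib_left)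
  also have "\<dots> \<le> C * charge n (A1 \<union> A2) x * 3"
  proof (rule mult_left_mono)
    have "(\<Sum>b\<in>B. charge n A2 b) \<le> (\<Sum>b\<in>{0..s}. charge n A2 b)"
      by (intro sum_mono2) (auto simp: B_def)
    also have "\<dots> = 1 + s / 2^(n - Min A2)"
      by (simp add: sum.atLeast_Suc_atMost charge_def)
    also have "\<dots> \<le> 3"
    proof -
      have "s \<le> 2 * 2^(n - Min A2)"
        using sum_pow_le[of A2 n] A(1) by (cases "A2 = {}") (auto simp: s_def)
      hence "real s \<le> 2 * 2^(n - Min A2)"
        by (metis of_nat_le_iff of_nat_mult of_nat_numeral of_nat_power)
      thus ?thesis
        by (simp add: divide_le_eq)
    qed
    finally show "(\<Sum>b\<in>B. charge n A2 b) \<le> 3" .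
  qed (use C in simp)
  finally show ?thesis
    by (simp add: mult_ac)
qed

section \<open>Counting weightings with prescribed atom masses\<close>

text \<open>If \<open>Min A\<close> is supported, the mass of \<open>A\<close> and the other weights
  determine the weight at \<open>Min A\<close>. Deleting that coordinate is therefore injective and
  saves a factor \<open>2^(n - Min A)\<close>. By disjointness the remaining constraints survive the
  deletion, and \<open>J\<close> varies to allow it.\<close>

lemma card_consistent_PiE:
  assumes "finite J" "disjoint_atoms ps" "covered ps \<subseteq> J" "J \<subseteq> {1..n}"
  shows "real (card {w \<in> (\<Pi>\<^sub>E i\<in>J. {1..2^(n-i)}). consistent (k, w) ps})
           \<le> (\<Prod>i\<in>J. 2^(n-i)) * total_charge n ps"
  using assms
proof (induction ps arbitrary: J)
  case Nil
  then show ?case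
    by (simp add: card_PiE)
next
  case (Cons p ps)
  obtain A x where p: "p = (A, x)"
    by force
  define W where "W = (\<lambda>J ps. {w \<in> (\<Pi>\<^sub>E i\<in>J. {1..2^(n-i)}). consistent (k, w) ps})"
  have fin: "finite (W J ps)" if "finite J" for J ps
    unfolding W_def using that by (intro finite_subset[OF Collect_restrict] finite_PiE) auto
  have prems: "A \<subseteq> J" "A \<subseteq> {1..n}" "finite A" "A \<inter> covered ps = {}" "covered ps \<subseteq> J"
    "disjoint_atoms ps"
    using Cons.prems finite_subset[of A J] p by auto
  show ?case
  \<comment> \<open>No coordinate is deleted in the first case: mass zero has charge 1 and its
    constraint is dropped, while a positive mass is impossible for an atom that misses the
    support.\<close>
  proof (cases "x = 0 \<or> Min A \<notin> A \<inter> {1..k}")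
    case True
    show ?thesis
    proof (cases "x = 0")
      case True
      have "card (W J (p # ps)) \<le> card (W J ps)"
        using fin[OF Cons.prems(1)] by (intro card_mono) (auto simp: W_def)
      also have "real \<dots> \<le> (\<Prod>i\<in>J. 2^(n-i)) * total_charge n ps"
        unfolding W_def using Cons.prems prems by (intro Cons.IH) auto
      finally show ?thesis
        using True by (simp add: W_def p charge_def)
    next
      case False
      have "A \<inter> {1..k} = {}"
      proof (rule ccontr)
        assume "A \<inter> {1..k} \<noteq> {}"
        then obtain i where i: "i \<in> A" "i \<le> k"
          by auto
        hence "Min A \<in> A" "Min A \<le> i"
          using prems by (auto intro: Min_in)
        with i True False prems show False
          by auto
      qed
      hence "W J (p # ps) = {}"
        using False by (auto simp: W_def p mass_def)
      thus ?thesis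
        unfolding W_def by (metis card.empty of_nat_0 mult_nonneg_nonneg prod_nonneg
            total_charge_nonneg zero_le_numeral zero_le_power)
    qed
  next
    case False
    define i where "i = Min A"
    have i: "i \<in> A \<inter> {1..k}" "i \<in> J"
      using False prems by (auto simp: i_def)
    define r where "r = (\<lambda>w :: nat \<Rightarrow> nat. restrict w (J - {i}))"
    have mass_r: "mass (k, r w) B = mass (k, w) B" if "B \<subseteq> J - {i}" for w B
      unfolding mass_def r_def using that by (intro sum.cong) auto
    have split: "mass (k, w) A = w i + mass (k, w) (A - {i})" for w
    proof -
      have "mass (k, w) ({i} \<union> (A - {i})) = mass (k, w) {i} + mass (k, w) (A - {i})"
        by (intro mass_Un) auto
      thus ?thesis
        using i by (simp add: mass_def insert_absorb)
    qed
    have "inj_on r (W J (p # ps))"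
    proof (rule inj_onI)
      fix w w' assume w: "w \<in> W J (p # ps)" "w' \<in> W J (p # ps)" and eq: "r w = r w'"
      have "A - {i} \<subseteq> J - {i}"
        using prems by auto
      hence "mass (k, w) (A - {i}) = mass (k, w') (A - {i})"
        using mass_r eq by metis
      hence "w i = w' i"
        using w split[of w] split[of w'] by (simp add: W_def p)
      moreover have "w l = w' l" if "l \<in> J - {i}" for l
        using fun_cong[OF eq, of l] that by (simp add: r_def)
      ultimately have "w l = w' l" if "l \<in> J" for l
        using that by blast
      thus "w = w'"
        using w by (intro PiE_ext[of w J _ w']) (auto simp: W_def)
    qed
    moreover have "r ` W J (p # ps) \<subseteq> W (J - {i}) ps"
    proof
      fix u assume "u \<in> r ` W J (p # ps)"
      then obtain w where w: "w \<in> W J (p # ps)" "u = r w"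
        by auto
      have "mass (k, r w) B = y" if "(B, y) \<in> set ps" for B y
      proof -
        have "B \<subseteq> J - {i}"
          using that prems i by force
        thus ?thesis
          using mass_r w that by (auto simp: W_def consistent_def)
      qed
      thus "u \<in> W (J - {i}) ps"
        using w by (auto simp: W_def consistent_def r_def PiE_iff)
    qed
    ultimately have "card (W J (p # ps)) \<le> card (W (J - {i}) ps)"
      using fin Cons.prems(1) by (intro card_inj_on_le) auto
    also have "real \<dots> \<le> (\<Prod>i\<in>J - {i}. 2^(n-i)) * total_charge n ps"
      unfolding W_def using Cons.prems prems i by (intro Cons.IH) auto
    also have "(\<Prod>i\<in>J - {i}. (2::real)^(n-i)) = (\<Prod>i\<in>J. 2^(n-i)) / 2^(n-i)"
      using Cons.prems(1) i by (simp add: prod.remove[of J i])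
    finally show ?thesis
      using False by (simp add: W_def p charge_def i_def)
  qed
qed

lemma card_consistent_weightings:
  assumes "disjoint_atoms ps" "covered ps \<subseteq> {1..n}"
  shows "real (card {w \<in> weightings n. consistent (k, w) ps})
           \<le> card (weightings n) * total_charge n ps"
  using card_consistent_PiE[of "{1..n}" ps n k] assms by (simp add: weightings_def card_PiE)

section \<open>Distributions induced by the inputs\<close>

lemma
  assumes "z \<in> inputs n L" "2^L \<le> n"
  shows fst_inputs: "1 \<le> fst z" "fst z \<le> n" and snd_inputs: "snd z \<in> weightings n"
proof -
  obtain j where j: "j < L" "fst z = 2^j" "snd z \<in> weightings n"
    using assms by (auto simp: inputs_def)
  have "(2::nat)^j \<le> 2^L"
    using j by (intro power_increasing) auto
  also note assms(2)
  finally show "1 \<le> fst z" "fst z \<le> n" "snd z \<in> weightings n"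
    using j by auto
qed

lemma dist_of_props:
  assumes "z \<in> inputs n L" "2^L \<le> n"
  shows set_dist_of: "set_pmf (dist_of z) = {1..fst z}"
    and prob_dist_of: "measure_pmf.prob (dist_of z) S = mass z S / mass z {1..n}"
proof -
  define M where "M = (\<Sum>i\<in>{1..fst z}. replicate_mset (snd z i) i)"
  have count: "count M i = (if i \<in> {1..fst z} then snd z i else 0)" for i
    by (simp add: M_def count_sum if_distrib[of "count _"] cong: if_cong)
  have pos: "snd z i > 0" if "i \<in> {1..fst z}" for i
    using weightings_pos[OF snd_inputs[OF assms]] that fst_inputs[OF assms] by auto
  have set: "set_mset M = {1..fst z}"
    using pos by (auto simp: set_mset_def count split: if_splits)
  hence ne: "M \<noteq> {#}"
    using fst_inputs[OF assms] by force
  show set': "set_pmf (dist_of z) = {1..fst z}"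
    unfolding dist_of_def M_def[symmetric] using set ne by simp
  have "size M = mass z {1..n}"
    using fst_inputs[OF assms] by (simp add: M_def mass_def  Int_absorb1)
  hence pmf: "pmf (dist_of z) i = (if i \<in> {1..fst z} then snd z i else 0) / mass z {1..n}" for i
    unfolding dist_of_def M_def[symmetric] using ne by (simp add: count)
  have "measure_pmf.prob (dist_of z) S = measure_pmf.prob (dist_of z) (S \<inter> {1..fst z})"
    by (metis measure_Int_set_pmf set')
  also have "\<dots> = (\<Sum>i\<in>S \<inter> {1..fst z}. pmf (dist_of z) i)"
    by (intro measure_measure_pmf_finite) auto
  also have "\<dots> = mass z S / mass z {1..n}"
    by (simp add: pmf mass_def sum_divide_distrib)
  finally show "measure_pmf.prob (dist_of z) S = mass z S / mass z {1..n}" .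
qed

text \<open>Once every atom lies inside or outside \<open>S\<close>, numerator and denominator of
  the answer are sums of recorded masses. The answer is thus the same for all inputs consistent with
  \<open>ps\<close>.\<close>

lemma prob_dist_of_consistent:
  assumes "z \<in> inputs n L" "2^L \<le> n" "disjoint_atoms ps" "covered ps = {1..n}" "consistent z ps"
    and refined: "\<And>p. p \<in> set ps \<Longrightarrow> fst p \<subseteq> S \<or> fst p \<inter> S = {}"
  shows "measure_pmf.prob (dist_of z) S =
    real (\<Sum>p\<leftarrow>filter (\<lambda>p. fst p \<subseteq> S) ps. snd p) / real (\<Sum>p\<leftarrow>ps. snd p)"
proof -
  let ?qs = "filter (\<lambda>p. fst p \<subseteq> S) ps"
  have "S \<inter> {1..n} = covered ?qs"
  proof -
    have "S \<inter> covered ps = covered ?qs"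
      using refined by (auto simp: image_iff)
    thus ?thesis
      by (simp only: assms(4))
  qed
  moreover have "mass z S = mass z (S \<inter> {1..n})"
    unfolding mass_def using fst_inputs[OF assms(1,2)] by (intro sum.cong) auto
  moreover have "mass z (covered ?qs) = (\<Sum>p\<leftarrow>?qs. snd p)"
    using assms by (intro mass_covered sorted_wrt_filter) (auto simp: consistent_def)
  moreover have "mass z {1..n} = (\<Sum>p\<leftarrow>ps. snd p)"
    using mass_covered[of ps z] assms by simp
  ultimately show ?thesis
    using prob_dist_of[OF assms(1,2), of S] by simp
qed

section \<open>Refining the atoms by one query\<close>

lemma card_refine_atoms:
  fixes Z :: "(nat \<times> (nat \<Rightarrow> nat)) set"
  assumes Z: "finite Z" "\<And>z. z \<in> Z \<Longrightarrow> snd z \<in> weightings n" and C: "0 \<le> C"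
    and refined: "\<And>ps. disjoint_atoms ps \<Longrightarrow> covered ps = {1..n} \<Longrightarrow> length ps = m \<Longrightarrow>
            (\<And>p. p \<in> set ps \<Longrightarrow> fst p \<subseteq> S \<or> fst p \<inter> S = {}) \<Longrightarrow>
            real (card {z \<in> Z. consistent z ps}) \<le> C * total_charge n ps"
    and "disjoint_atoms (done @ todo)" "covered (done @ todo) = {1..n}"
    and "length done + 2 * length todo = m"
    and "\<And>p. p \<in> set done \<Longrightarrow> fst p \<subseteq> S \<or> fst p \<inter> S = {}"
  shows "real (card {z \<in> Z. consistent z (done @ todo)})
           \<le> 3 ^ length todo * C * total_charge n (done @ todo)"
  using assms(5-)
proof (induction todo arbitrary: "done")
  case Nil
  then show ?case
    using refined[of "done"] by simp
next
  case (Cons p todo)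
  obtain A x where p: "p = (A, x)"
    by force
  \<comment> \<open>All other atoms are frozen into \<open>Z'\<close> and their charges into
    \<open>C'\<close>, which leaves a single atom to split.\<close>
  define Z' where "Z' = {z \<in> Z. consistent z (done @ todo)}"
  define C' where "C' = 3 ^ length todo * C * total_charge n (done @ todo)"
  have split: "real (card {z \<in> Z'. mass z (A \<inter> S) = a \<and> mass z (A - S) = b})
      \<le> C' * charge n (A \<inter> S) a * charge n (A - S) b" for a b
  proof -
    let ?done = "(A \<inter> S, a) # (A - S, b) # done"
    have "real (card {z \<in> Z. consistent z (?done @ todo)})
        \<le> 3 ^ length todo * C * total_charge n (?done @ todo)"
    proof (rule Cons.IH)
      have "covered (?done @ todo) = covered (done @ p # todo)"
        using p by auto
      thus "covered (?done @ todo) = {1..n}"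
        using Cons.prems(2) by simp
      show "disjoint_atoms (?done @ todo)"
        using Cons.prems(1) p by (auto simp: sorted_wrt_append)
      show "length ?done + 2 * length todo = m"
        using Cons.prems(3) by simp
      show "fst p \<subseteq> S \<or> fst p \<inter> S = {}" if "p \<in> set ?done" for p
        using that Cons.prems(4)[of p] by auto
    qed
    also have "{z \<in> Z. consistent z (?done @ todo)}
        = {z \<in> Z'. mass z (A \<inter> S) = a \<and> mass z (A - S) = b}"
      by (auto simp: Z'_def)
    finally show ?thesis
      by (simp add: C'_def mult_ac)
  qed
  have Z': "finite Z'" "\<And>z. z \<in> Z' \<Longrightarrow> snd z \<in> weightings n"
    using Z by (auto simp: Z'_def)
  have C': "0 \<le> C'"
    using C by (simp add: C'_def mult_nonneg_nonneg del: total_charge_simps)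
  have A: "A \<subseteq> {1..n}"
    using Cons.prems(2) p by auto
  hence Min_in: "A \<noteq> {} \<Longrightarrow> Min A \<in> A"
    using finite_subset[of A "{1..n}"] by simp
  have "real (card {z \<in> Z'. mass z A = x}) \<le> 3 * C' * charge n A x"
  \<comment> \<open>The half containing \<open>Min A\<close> has to take the role of
    \<open>A1\<close>.\<close>
  proof (cases "A \<noteq> {} \<longrightarrow> Min A \<in> S")
    case True
    have "(A \<inter> S) \<union> (A - S) = A"
      by auto
    thus ?thesis
      using card_split_atom[OF Z', of "A \<inter> S" "A - S" C' x] A True Min_in C' split by auto
  next
    case False
    have "(A - S) \<union> (A \<inter> S) = A"
      by auto
    moreover have "real (card {z \<in> Z'. mass z (A - S) = a \<and> mass z (A \<inter> S) = b})
      \<le> C' * charge n (A - S) a * charge n (A \<inter> S) b" for a b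
      using split[of b a] by (simp add: conj_commute mult_ac)
    ultimately show ?thesis
      using card_split_atom[OF Z', of "A - S" "A \<inter> S" C' x] A False Min_in C' by auto
  qed
  moreover have "{z \<in> Z'. mass z A = x} = {z \<in> Z. consistent z (done @ p # todo)}"
    by (auto simp: Z'_def p)
  ultimately show ?case
    by (simp add: C'_def p mult_ac)
qed

section \<open>Inputs solved by a deterministic tree\<close>

text \<open>For sizes \<open>2^i < 2^j\<close>, a common estimate would satisfy 3/2 *
  \<open>2^i\<close> \<le> 3/4 * \<open>2^j\<close> \<le> 4/3 * \<open>2^i\<close>.\<close>

lemma approximates_supp_unique:
  assumes "z \<in> inputs n L" "z' \<in> inputs n L" "2^L \<le> n"
    and "approximates_supp (dist_of z) r" "approximates_supp (dist_of z') r"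
  shows "fst z = fst z'"
proof -
  have *: False if "i < j" "3/4 * (2::real)^j \<le> r" "r \<le> 4/3 * 2^i" for i j :: nat
  proof -
    have "(2::real)^Suc i \<le> 2^j"
      using that(1) by (intro power_increasing) auto
    moreover have "(0::real) < 2^i"
      by simp
    ultimately show False
      using that(2,3) by simp
  qed
  obtain i j where ij: "fst z = 2^i" "fst z' = 2^j"
    using assms(1,2) by (auto simp: inputs_def)
  have "\<not> i < j" "\<not> j < i"
    using *[of i j] *[of j i] assms(4,5) set_dist_of[OF assms(1,3)] set_dist_of[OF assms(2,3)] ij
    by (auto simp: approximates_supp_def)
  thus ?thesis
    using ij by simp
qed

text \<open>Induction on the tree for arbitrary atoms. A query costs \<open>3 ^ length ps\<close>
  and doubles the number of atoms, so with \<open>m\<close> atoms the exponent obeys e(d+1, m) = m +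
  e(d, 2m), e(0, m) = 0, solved by m(2^d - 1).\<close>

lemma card_solved_consistent:
  assumes "2^L \<le> n" "disjoint_atoms ps" "covered ps = {1..n}"
  shows "real (card {z \<in> solved n L d t. consistent z ps})
           \<le> card (weightings n) * 3 ^ (length ps * (2^d - 1)) * total_charge n ps"
  using assms(2,3)
proof (induction t arbitrary: ps d)
  case (Output r)
  define Z where "Z = {z \<in> solved n L d (Output r). consistent z ps}"
  have "real (card Z) \<le> card (weightings n) * total_charge n ps"
  proof (cases "Z = {}")
    case False
    then obtain z where z: "z \<in> Z"
      by auto
    have "snd ` Z \<subseteq> {w \<in> weightings n. consistent (fst z, w) ps}" "inj_on snd Z"
    proof -
      \<comment> \<open>A leaf gives a single estimate, which fixes the support size; only the
        weighting remains to be counted.\<close>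
      have eq: "fst z' = fst z" if "z' \<in> Z" for z'
        using that z by (intro approximates_supp_unique[OF _ _ assms(1)])
          (auto simp: Z_def solved_def)
      show "inj_on snd Z"
        using eq by (metis inj_onI prod_eqI)
      show "snd ` Z \<subseteq> {w \<in> weightings n. consistent (fst z, w) ps}"
      proof
        fix w assume "w \<in> snd ` Z"
        then obtain z' where z': "z' \<in> Z" "w = snd z'"
          by auto
        hence "z' = (fst z, w)"
          using eq by (metis prod.collapse)
        thus "w \<in> {w \<in> weightings n. consistent (fst z, w) ps}"
          using z' by (auto simp: Z_def solved_def inputs_def)
      qed
    qed
    hence "card Z \<le> card {w \<in> weightings n. consistent (fst z, w) ps}"
      by (intro card_inj_on_le[of snd]) auto
    also have "real \<dots> \<le> card (weightings n) * total_charge n ps"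
      using Output by (intro card_consistent_weightings) auto
    finally show ?thesis
      by simp
  qed simp
  also have "\<dots> \<le> card (weightings n) * 3 ^ (length ps * (2^d - 1)) * total_charge n ps"
    by (intro mult_right_mono) (auto simp: mult_le_cancel_left1)
  finally show ?case
    unfolding Z_def .
next
  case (Query S f)
  show ?case
  proof (cases d)
    case 0
    hence "solved n L d (Query S f) = {}"
      by (auto simp: solved_def)
    thus ?thesis
      by simp
  next
    case (Suc e)
    let ?C = "card (weightings n) * 3 ^ (2 * length ps * (2^e - 1)) :: real"
    have "real (card {z \<in> solved n L d (Query S f). consistent z ([] @ ps)})
        \<le> 3 ^ length ps * ?C * total_charge n ([] @ ps)"
    proof (rule card_refine_atoms[where S = S and m = "2 * length ps"])
      fix qs :: "(nat set \<times> nat) list"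
      assume qs: "disjoint_atoms qs" "covered qs = {1..n}" "length qs = 2 * length ps"
        "\<And>p. p \<in> set qs \<Longrightarrow> fst p \<subseteq> S \<or> fst p \<inter> S = {}"
      define a where
        "a = real (\<Sum>p\<leftarrow>filter (\<lambda>p. fst p \<subseteq> S) qs. snd p) / real (\<Sum>p\<leftarrow>qs. snd p)"
      \<comment> \<open>The answer \<open>a\<close> depends on \<open>qs\<close> alone, so all
        consistent inputs enter the same subtree with one query fewer left.\<close>
      have "{z \<in> solved n L d (Query S f). consistent z qs}
          \<subseteq> {z \<in> solved n L e (f a). consistent z qs}"
        using prob_dist_of_consistent[OF _ assms(1) qs(1,2) _ qs(4)] Suc
        by (auto simp: solved_def a_def)
      hence "card {z \<in> solved n L d (Query S f). consistent z qs}
          \<le> card {z \<in> solved n L e (f a). consistent z qs}"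
        by (intro card_mono) auto
      also have "real \<dots> \<le> ?C * total_charge n qs"
        using Query.IH[of "f a" qs e] qs by simp
      finally show "real (card {z \<in> solved n L d (Query S f). consistent z qs})
          \<le> ?C * total_charge n qs"
        by simp
    qed (use Query.prems snd_inputs[OF _ assms(1)] in \<open>auto simp: solved_def\<close>)
    also have "3 ^ length ps * ?C = card (weightings n) * 3 ^ (length ps + 2 * length ps * (2^e - 1))"
      by (simp add: power_add)
    also have "length ps + 2 * length ps * (2^e - 1) = length ps * (2^d - 1)"
    proof -
      obtain y where "(2::nat)^e = Suc y"
        by (metis not0_implies_Suc power_not_zero zero_neq_numeral)
      thus ?thesis
        by (simp add: Suc algebra_simps)
    qed
    finally show ?thesis
      by simp
  qed
qed

text \<open>Start from the single atom \<open>{1..n}\<close>: at most \<open>2 * 2^(n-1)\<close>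
  positive total masses, each of charge \<open>1 / 2^(n-1)\<close>, contribute a factor 2. The
  exponent \<open>2^d - 1\<close> leaves one spare factor 3, and the resulting 2/3 matches the
  success probability.\<close>

lemma card_solved:
  assumes "2^L \<le> n"
  shows "3 * real (card (solved n L d t)) \<le> 2 * card (weightings n) * 3 ^ 2^d"
proof -
  let ?N = "(2::nat)^(n-1)"
  let ?S = "\<lambda>x. {z \<in> solved n L d t. consistent z [({1..n}, x)]}"
  have n: "1 \<le> n"
    using assms by (metis one_le_numeral one_le_power order_trans)
  have "solved n L d t \<subseteq> (\<Union>x\<in>{1..2*?N}. ?S x)"
  proof
    fix z assume z: "z \<in> solved n L d t"
    hence zi: "z \<in> inputs n L"
      by (simp add: solved_def)
    note zp = fst_inputs[OF zi assms] snd_inputs[OF zi assms]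
    have "mass z {1..n} \<le> (\<Sum>i\<in>{1..n}. 2^(n-i))"
      using zp by (intro mass_le) auto
    also have "\<dots> \<le> 2 * ?N"
      using n by (rule sum_pow_atLeast)
    finally have "mass z {1..n} \<le> 2 * ?N" .
    moreover have "mass z {1..n} > 0"
      using zp by (intro mass_pos[of z n 1]) auto
    ultimately show "z \<in> (\<Union>x\<in>{1..2*?N}. ?S x)"
      using z by auto
  qed
  hence "card (solved n L d t) \<le> card (\<Union>x\<in>{1..2*?N}. ?S x)"
    by (intro card_mono) auto
  also have "\<dots> \<le> (\<Sum>x\<in>{1..2*?N}. card (?S x))"
    by (intro card_UN_le) auto
  finally have "real (card (solved n L d t)) \<le> (\<Sum>x\<in>{1..2*?N}. real (card (?S x)))"
    by (simp flip: of_nat_sum)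
  also have "\<dots> \<le> (\<Sum>x\<in>{1..2*?N}. card (weightings n) * 3 ^ (2^d - 1) * (1 / 2^(n-1)))"
  proof (intro sum_mono)
    fix x assume "x \<in> {1..2*?N}"
    moreover have "Min {1..n} = 1"
      using n by (intro Min_eqI) auto
    ultimately show "real (card (?S x)) \<le> card (weightings n) * 3 ^ (2^d - 1) * (1 / 2^(n-1))"
      using card_solved_consistent[OF assms, of "[({1..n}, x)]" d t] by (simp add: charge_def)
  qed
  also have "\<dots> = 2 * card (weightings n) * 3 ^ (2^d - 1)"
    by simp
  finally have "3 * real (card (solved n L d t)) \<le> 2 * card (weightings n) * 3 ^ Suc (2^d - 1)"
    unfolding power_Suc by linarith
  thus ?thesis
    by simp
qed

section \<open>Averaging over the algorithm's randomness\<close>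

text \<open>The expected number of solved inputs is at least 2/3 of all
  \<open>L * card (weightings n)\<close> inputs, while \<open>card_solved\<close> bounds it for
  almost every tree.\<close>

lemma scales_le:
  assumes A: "randomized_algorithm n A" "estimates_support_size n A" "query_bound n A q"
    and L: "2^L \<le> n"
  shows "L \<le> 3 ^ 2^q"
proof -
  interpret prob_space A
    using A(1) by (simp add: randomized_algorithm_def)
  define E where "E = (\<lambda>z. {t \<in> space A. approximates_supp (dist_of z) (estimate (dist_of z) t)})"
  let ?W = "card (weightings n)"
  have in_dists: "dist_of z \<in> dists_on n" if "z \<in> inputs n L" for z
    using set_dist_of[OF that L] fst_inputs[OF that L] by (auto simp: dists_on_def)
  have prob: "prob (E z) \<ge> 2/3" if "z \<in> inputs n L" for z
    using A(2) in_dists[OF that] by (auto simp: estimates_support_size_def E_def)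
  \<comment> \<open>A non-measurable set would have measure 0, below 2/3.\<close>
  have meas: "E z \<in> events" if "z \<in> inputs n L" for z
    using prob[OF that] measure_notin_sets[of "E z" A] by fastforce
  \<comment> \<open>There are finitely many inputs, so their exceptional null sets can be
    merged.\<close>
  have "AE t in A. \<forall>z\<in>inputs n L. num_queries (dist_of z) t \<le> q"
    using A(3) in_dists by (intro AE_finite_allI) (auto simp: query_bound_def)
  hence le: "AE t in A. (\<Sum>z\<in>inputs n L. indicator (E z) t) \<le> 2 * ?W * 3 ^ 2^q / (3::real)"
  proof (rule AE_mp, intro AE_I2 impI)
    fix t assume t: "t \<in> space A" "\<forall>z\<in>inputs n L. num_queries (dist_of z) t \<le> q"
    have "(\<Sum>z\<in>inputs n L. indicator (E z) t) = real (card {z \<in> inputs n L. t \<in> E z})"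
      by (simp add: indicator_def sum.If_cases Int_def)
    also have "{z \<in> inputs n L. t \<in> E z} = solved n L q t"
      using t by (auto simp: solved_def E_def)
    finally show "(\<Sum>z\<in>inputs n L. indicator (E z) t) \<le> 2 * ?W * 3 ^ 2^q / (3::real)"
      using card_solved[OF L, of q t] by simp
  qed
  have "card (inputs n L) = L * ?W"
    by (simp add: inputs_def card_cartesian_product card_image inj_on_def)
  hence "2/3 * (real L * ?W) = (\<Sum>z\<in>inputs n L. 2/3)"
    by simp
  also have "\<dots> \<le> (\<Sum>z\<in>inputs n L. prob (E z))"
    by (intro sum_mono prob)
  also have "\<dots> = expectation (\<lambda>t. \<Sum>z\<in>inputs n L. indicator (E z) t)"
    using meas sets.sets_into_space
    by (subst Bochner_Integration.integral_sum)
      (auto simp: Int_absorb2 integrable_indicator_iff less_top[symmetric] intro!: sum.cong)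
  also have "\<dots> \<le> expectation (\<lambda>_. 2 * ?W * 3 ^ 2^q / 3)"
    using meas le
    by (intro integral_mono_AE Bochner_Integration.integrable_sum)
      (auto simp: integrable_indicator_iff less_top[symmetric])
  also have "\<dots> = 2/3 * (3 ^ 2^q * ?W)"
    by (simp add: prob_space)
  finally have "real L * ?W \<le> 3 ^ 2^q * ?W"
    by simp
  hence "real L \<le> 3 ^ 2^q"
    using card_weightings_pos[of n] by simp
  thus ?thesis
    by (metis of_nat_le_iff of_nat_numeral of_nat_power)
qed

section \<open>Taking logarithms\<close>

text \<open>With \<open>L\<close> the integer part of the binary logarithm of \<open>n\<close>, the
  bound on \<open>L\<close> gives \<open>ln n\<close> \<le> \<open>4 ^ 2^q\<close>; two more
  logarithms yield \<open>Suc q\<close>, which is at most \<open>2 * q\<close>.\<close>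

lemma ln_ln_ln_le:
  assumes "16 \<le> n" and scales: "\<And>L. 2^L \<le> n \<Longrightarrow> L \<le> 3 ^ 2^q"
  shows "1/2 * ln (ln (ln (real n))) \<le> real q"
proof -
  define L where "L = floor_log n"
  have n: "2^L \<le> n" "n < 2 ^ Suc L"
    using assms(1) floor_log_exp2_le[of n] floor_log_exp2_gt[of n] by (auto simp: L_def)
  \<comment> \<open>As 2^4 \<le> \<open>n\<close>, the value \<open>q = 0\<close> would give 4 \<le>
    3.\<close>
  have "q \<noteq> 0"
    using scales[of 4] assms(1) by (auto intro: ccontr)
  \<comment> \<open>This makes the iterated logarithms positive where monotonicity of
    \<open>ln\<close> is applied.\<close>
  have "exp 1 < real n"
    using exp_le assms(1) by (simp add: order.strict_trans1)
  hence ln1: "1 < ln (real n)"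
    using ln_less_cancel_iff[of "exp 1" "real n"] assms(1) by simp
  hence ln0: "0 < ln (ln (real n))"
    by simp
  have ln2: "ln (2::real) \<le> 1"
    using ln_le_minus_one[of "2::real"] by simp
  have "real n \<le> 2 ^ Suc L"
    using n(2) by (metis less_imp_le of_nat_le_iff of_nat_numeral of_nat_power)
  hence "ln (real n) \<le> real (Suc L) * ln 2"
    using assms(1) by (subst ln_realpow[symmetric]) auto
  also have "\<dots> \<le> real (Suc L)"
    using mult_left_mono[OF ln2, of "real (Suc L)"] by simp
  \<comment> \<open>Raising the base from 3 to 4 absorbs the successor.\<close>
  also have "Suc L \<le> 4 ^ 2^q"
  proof -
    have "(3::nat) ^ 2^q < 4 ^ 2^q"
      by (intro power_strict_mono) auto
    thus ?thesis
      using scales[OF n(1)] by linarith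
  qed
  hence "real (Suc L) \<le> 4 ^ 2^q"
    by (metis of_nat_le_iff of_nat_numeral of_nat_power)
  finally have "ln (ln (real n)) \<le> ln (4 ^ 2^q)"
    using ln1 by simp
  also have "\<dots> = 2^q * ln (2^2)"
    by (simp add: ln_realpow)
  also have "\<dots> \<le> 2^q * 2"
    using ln2 by (subst ln_realpow) auto
  finally have "ln (ln (ln (real n))) \<le> ln (2 ^ Suc q)"
    using ln0 by (subst ln_le_cancel_iff) (auto simp: mult.commute)
  also have "\<dots> \<le> real (Suc q)"
    using mult_left_mono[OF ln2, of "real (Suc q)"] by (subst ln_realpow) auto
  also have "\<dots> \<le> 2 * real q"
    using \<open>q \<noteq> 0\<close> by simp
  finally show ?thesis
    by simp
qed

theorem theorem3p2:
  "\<exists>c>0::real. \<exists>n\<^sub>0::nat. \<forall>n\<ge>n\<^sub>0. \<forall>(A :: set_eval_tree measure) (q :: nat).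
     randomized_algorithm n A \<longrightarrow> estimates_support_size n A \<longrightarrow> query_bound n A q \<longrightarrow>
     real q \<ge> c * ln (ln (ln (real n)))"
proof (intro exI[of _ "1/2"] exI[of _ 16] conjI allI impI)
  fix n q :: nat and A :: "set_eval_tree measure"
  assume "16 \<le> n" "randomized_algorithm n A" "estimates_support_size n A" "query_bound n A q"
  thus "1/2 * ln (ln (ln (real n))) \<le> real q"
    using scales_le by (intro ln_ln_ln_le) auto
qed simp

end
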